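(* Let $\mathcal{C}=\langle V,S,\chi,\ell\rangle$ and $\mathcal{D}=\langle V',S',\chi',\ell'\rangle$ be simplicial models and $f:(\mathcal{C},X)\to(\mathcal{D},Y)$ a morphism of pointed simplicial models. Let $\varphi$ be a guarded positive epistemic formula. Then $\mathcal{D},Y\models\varphi$ implies $\mathcal{C},X\models\varphi$.
   Context: Agents: finite nonempty set $A$; atoms $\mathrm{AP}=\bigcup_{a\in A}\mathrm{AP}_a$ (disjoint union), $\mathrm{AP}_B=\bigcup_{a\in B}\mathrm{AP}_a$. Formulas $\varphi::=p\mid\neg\varphi\mid\varphi\wedge\varphi\mid K_a\varphi$ with derived $\vee,\Rightarrow$, $\mathrm{false}$; $\mathrm{alive}(a):=\neg K_a\,\mathrm{false}$, and $\mathrm{alive}(B):=\bigwedge_{a\in B}\mathrm{alive}(a)$. Guarded positive epistemic formulas: $\varphi::=(\mathrm{alive}(B)\Rightarrow\psi)\mid\varphi\wedge\varphi\mid\varphi\vee\varphi\mid K_a\varphi$ with $a\in A$, $B\subseteq A$, and $\psi$ a propositional formula over $\mathrm{AP}_B$ ($\psi::=p\mid\neg\psi\mid\psi\wedge\psi$, $p\in\mathrm{AP}_B$). A simplicial model is a chromatic simplicial complex $\langle V,S,\chi\rangle$ ($S$ a family of nonempty subsets of $V$ containing singletons, closed under nonempty subsets, $\chi:V\to A$ injective on each simplex) with $\ell:\mathcal{F}(\mathcal{C})\to\mathcal{P}(\mathrm{AP})$ on its set of facets (maximal simplexes). A morphism of simplicial models is a map $f:V\to V'$ preserving simplexes and colours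 such that whenever $X\in\mathcal{F}(\mathcal{C})$, $Y\in\mathcal{F}(\mathcal{D})$ and $f(X)\subseteq Y$, $\ell'(Y)\cap\mathrm{AP}_{\chi(X)}=\ell(X)\cap\mathrm{AP}_{\chi(X)}$. A pointed simplicial model is $(\mathcal{C},X)$ with $X$ a facet; a pointed morphism $f:(\mathcal{C},X)\to(\mathcal{D},Y)$ additionally satisfies $f(X)\subseteq Y$. Semantics at a facet $X$: $p$ iff $p\in\ell(X)$; Boolean connectives as usual; $K_a\varphi$ iff $\varphi$ holds at every facet $Y'$ with $a\in\chi(X\cap Y')$. *)

theory Defs
  imports Main "HOL-Library.Disjoint_Sets"
begin

(* The atoms of the agents in B; AP a is the set of atoms of agent a. *)
definition atoms_of :: "('a \<Rightarrow> 'p set) \<Rightarrow> 'a set \<Rightarrow> 'p set" where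
  "atoms_of AP B = (\<Union>a\<in>B. AP a)"

definition signature :: "'a set \<Rightarrow> ('a \<Rightarrow> 'p set) \<Rightarrow> bool" where
  "signature A AP \<longleftrightarrow> finite A \<and> A \<noteq> {} \<and> disjoint_family_on AP A"


datatype ('p, 'a) fm =
    Atom 'p
  | Neg "('p, 'a) fm"
  | Conj "('p, 'a) fm" "('p, 'a) fm"
  | K 'a "('p, 'a) fm"

definition Disj :: "('p, 'a) fm \<Rightarrow> ('p, 'a) fm \<Rightarrow> ('p, 'a) fm" where
  "Disj \<phi> \<psi> = Neg (Conj (Neg \<phi>) (Neg \<psi>))"

definition Imp :: "('p, 'a) fm \<Rightarrow> ('p, 'a) fm \<Rightarrow> ('p, 'a) fm" where
  "Imp \<phi> \<psi> = Disj (Neg \<phi>) \<psi>"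

(* The grammar has no constants, so falsity is p \<and> \<not>p for a fixed atom p of the
   set P of all atoms. If P is empty, then there is no formula over P at all
   (and p is an arbitrary element of the type). *)
definition Fls :: "'p set \<Rightarrow> ('p, 'a) fm" where
  "Fls P = (let p = SOME p. p \<in> P in Conj (Atom p) (Neg (Atom p)))"

definition alive :: "'p set \<Rightarrow> 'a \<Rightarrow> ('p, 'a) fm" where
  "alive P a = Neg (K a (Fls P))"

(* The conjunction of all alive(a), a in B, where B is enumerated by a list;
   the empty conjunction is truth. *)
fun alive_all :: "'p set \<Rightarrow> 'a list \<Rightarrow> ('p, 'a) fm" where
  "alive_all P [] = Neg (Fls P)"
| "alive_all P [a] = alive P a"
| "alive_all P (a # b # bs) = Conj (alive P a) (alive_all P (b # bs))"

inductive propositional :: "'p set \<Rightarrow> ('p, 'a) fm \<Rightarrow> bool" for P where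
  "p \<in> P \<Longrightarrow> propositional P (Atom p)"
| "propositional P \<psi> \<Longrightarrow> propositional P (Neg \<psi>)"
| "propositional P \<psi>1 \<Longrightarrow> propositional P \<psi>2 \<Longrightarrow> propositional P (Conj \<psi>1 \<psi>2)"

(* In the first rule every enumeration bs of B, hence every order of the conjuncts
   of alive(B), is admitted. *)
inductive guarded_positive :: "'a set \<Rightarrow> ('a \<Rightarrow> 'p set) \<Rightarrow> ('p, 'a) fm \<Rightarrow> bool"
  for A AP where
  "B \<subseteq> A \<Longrightarrow> distinct bs \<Longrightarrow> set bs = B \<Longrightarrow> propositional (atoms_of AP B) \<psi>
    \<Longrightarrow> guarded_positive A AP (Imp (alive_all (atoms_of AP A) bs) \<psi>)"
| "guarded_positive A AP \<phi>1 \<Longrightarrow> guarded_positive A AP \<phi>2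
    \<Longrightarrow> guarded_positive A AP (Conj \<phi>1 \<phi>2)"
| "guarded_positive A AP \<phi>1 \<Longrightarrow> guarded_positive A AP \<phi>2
    \<Longrightarrow> guarded_positive A AP (Disj \<phi>1 \<phi>2)"
| "a \<in> A \<Longrightarrow> guarded_positive A AP \<phi> \<Longrightarrow> guarded_positive A AP (K a \<phi>)"


(* label is only meaningful on facets. *)
record ('v, 'a, 'p) smodel =
  vertices :: "'v set"
  simplexes :: "'v set set"
  colour :: "'v \<Rightarrow> 'a"
  label :: "'v set \<Rightarrow> 'p set"

definition facets :: "('v, 'a, 'p) smodel \<Rightarrow> 'v set set" where
  "facets C = {X \<in> simplexes C. \<forall>Y \<in> simplexes C. X \<subseteq> Y \<longrightarrow> X = Y}"

definition simplicial_complex :: "'v set \<Rightarrow> 'v set set \<Rightarrow> bool" where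
  "simplicial_complex V S \<longleftrightarrow>
     (\<forall>X\<in>S. X \<noteq> {} \<and> X \<subseteq> V) \<and>
     (\<forall>v\<in>V. {v} \<in> S) \<and>
     (\<forall>X\<in>S. \<forall>Y. Y \<noteq> {} \<and> Y \<subseteq> X \<longrightarrow> Y \<in> S)"

definition chromatic_complex :: "'a set \<Rightarrow> ('v, 'a, 'p) smodel \<Rightarrow> bool" where
  "chromatic_complex A C \<longleftrightarrow>
     simplicial_complex (vertices C) (simplexes C) \<and>
     (\<forall>v \<in> vertices C. colour C v \<in> A) \<and>
     (\<forall>X \<in> simplexes C. inj_on (colour C) X)"

definition simplicial_model :: "'a set \<Rightarrow> ('a \<Rightarrow> 'p set) \<Rightarrow> ('v, 'a, 'p) smodel \<Rightarrow> bool" where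
  "simplicial_model A AP C \<longleftrightarrow>
     chromatic_complex A C \<and> (\<forall>X \<in> facets C. label C X \<subseteq> atoms_of AP A)"

definition morphism ::
  "('a \<Rightarrow> 'p set) \<Rightarrow> ('v, 'a, 'p) smodel \<Rightarrow> ('w, 'a, 'p) smodel \<Rightarrow> ('v \<Rightarrow> 'w) \<Rightarrow> bool" where
  "morphism AP C D f \<longleftrightarrow>
     (\<forall>v \<in> vertices C. f v \<in> vertices D) \<and>
     (\<forall>X \<in> simplexes C. f ` X \<in> simplexes D) \<and>
     (\<forall>v \<in> vertices C. colour D (f v) = colour C v) \<and>
     (\<forall>X \<in> facets C. \<forall>Y \<in> facets D. f ` X \<subseteq> Y \<longrightarrow>
        label D Y \<inter> atoms_of AP (colour C ` X) = label C X \<inter> atoms_of AP (colour C ` X))"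

definition pointed_morphism ::
  "('a \<Rightarrow> 'p set) \<Rightarrow> ('v, 'a, 'p) smodel \<Rightarrow> 'v set \<Rightarrow> ('w, 'a, 'p) smodel \<Rightarrow> 'w set
    \<Rightarrow> ('v \<Rightarrow> 'w) \<Rightarrow> bool" where
  "pointed_morphism AP C X D Y f \<longleftrightarrow>
     X \<in> facets C \<and> Y \<in> facets D \<and> morphism AP C D f \<and> f ` X \<subseteq> Y"

fun sat :: "('v, 'a, 'p) smodel \<Rightarrow> 'v set \<Rightarrow> ('p, 'a) fm \<Rightarrow> bool" where
  "sat C X (Atom p) \<longleftrightarrow> p \<in> label C X"
| "sat C X (Neg \<phi>) \<longleftrightarrow> \<not> sat C X \<phi>"
| "sat C X (Conj \<phi> \<psi>) \<longleftrightarrow> sat C X \<phi> \<and> sat C X \<psi>"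
| "sat C X (K a \<phi>) \<longleftrightarrow> (\<forall>Y \<in> facets C. a \<in> colour C ` (X \<inter> Y) \<longrightarrow> sat C Y \<phi>)"

end

theory Submission
  imports Defs
begin

text \<open>
  The proof is by induction on the formula. If \<open>alive B\<close> holds at \<open>X\<close> then \<open>B\<close> is contained
  in the colours of \<open>X\<close>, hence in those of \<open>Y\<close>, and the labels of \<open>X\<close> and \<open>Y\<close> agree on the atoms
  of \<open>B\<close>. For \<open>K a\<close>, simplexes have at most as many vertices as there are agents, so the image
  of an \<open>a\<close>-neighbour of \<open>X\<close> extends to a facet, which is an \<open>a\<close>-neighbour of \<open>Y\<close>.
\<close>

lemma sat_Disj [simp]: "sat C X (Disj \<phi> \<psi>) \<longleftrightarrow> sat C X \<phi> \<or> sat C X \<psi>"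
  by (simp add: Disj_def)

lemma sat_Imp [simp]: "sat C X (Imp \<phi> \<psi>) \<longleftrightarrow> (sat C X \<phi> \<longrightarrow> sat C X \<psi>)"
  by (simp add: Imp_def)

text \<open>It is a contradiction for whichever atom \<open>SOME\<close> picks, even if
  \<open>P\<close> is empty.\<close>

lemma not_sat_Fls [simp]: "\<not> sat C X (Fls P)"
  by (simp add: Fls_def Let_def)

text \<open>A facet is its own neighbour through each colour it carries, and falsity holds nowhere;
  so \<open>K a (Fls P)\<close> can hold at \<open>X\<close> only vacuously, when \<open>X\<close>
  has no vertex of colour \<open>a\<close>.\<close>

lemma sat_alive:
  assumes "X \<in> facets C"
  shows "sat C X (alive P a) \<longleftrightarrow> a \<in> colour C ` X"
  using assms by (auto simp: alive_def)

lemma sat_alive_all: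
  assumes "X \<in> facets C"
  shows "sat C X (alive_all P bs) \<longleftrightarrow> set bs \<subseteq> colour C ` X"
  by (induction P bs rule: alive_all.induct) (simp_all add: sat_alive [OF assms])

lemma sat_propositional_cong:
  assumes "propositional P \<psi>" "label D Y \<inter> P = label C X \<inter> P"
  shows "sat D Y \<psi> \<longleftrightarrow> sat C X \<psi>"
  using assms by induction auto

lemma simplex_vertices:
  assumes "chromatic_complex A C" "X \<in> simplexes C"
  shows "X \<subseteq> vertices C"
  using assms by (simp add: chromatic_complex_def simplicial_complex_def)

text \<open>The complex may be infinite, so a maximal simplex is sought by cardinality: the
  colouring embeds every simplex into the finite set \<open>A\<close>.\<close>

lemma ex_facet_superset:
  assumes "finite A" "chromatic_complex A C" "X \<in> simplexes C"
  obtains Y where "Y \<in> facets C" "X \<subseteq> Y"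
proof -
  have inj: "inj_on (colour C) Z" if "Z \<in> simplexes C" for Z
    using assms(2) that by (simp add: chromatic_complex_def)
  have sub: "colour C ` Z \<subseteq> A" if "Z \<in> simplexes C" for Z
    using simplex_vertices [OF assms(2) that] assms(2) by (auto simp: chromatic_complex_def)
  have fin: "finite Z" and card: "card Z \<le> card A" if "Z \<in> simplexes C" for Z
    using inj [OF that] sub [OF that] assms(1)
    by (simp_all add: inj_on_finite card_inj_on_le)
  have "\<exists>Y. (Y \<in> simplexes C \<and> X \<subseteq> Y) \<and> (\<forall>Z. Z \<in> simplexes C \<and> X \<subseteq> Z \<longrightarrow> card Z \<le> card Y)"
    using assms(3) card
    by (intro ex_has_greatest_nat [where b = "Suc (card A)" and k = X]) (auto simp: less_Suc_eq_le)
  then obtain Y where Y: "Y \<in> simplexes C" "X \<subseteq> Y"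
    and max: "\<And>Z. Z \<in> simplexes C \<Longrightarrow> X \<subseteq> Z \<Longrightarrow> card Z \<le> card Y"
    by blast
  \<comment> \<open>Greatest cardinality yields maximality for inclusion because \<open>Z\<close> is
    finite.\<close>
  have "Y = Z" if "Z \<in> simplexes C" "Y \<subseteq> Z" for Z
    using card_seteq [OF fin [OF that(1)] that(2)] max [OF that(1)] Y(2) that(2) by auto
  with Y show thesis
    by (intro that) (auto simp: facets_def)
qed

theorem theorem37:
  fixes A :: "'a set"
    and AP :: "'a \<Rightarrow> 'p set"
    and C :: "('v, 'a, 'p) smodel"
    and D :: "('w, 'a, 'p) smodel"
    and X :: "'v set"
    and Y :: "'w set"
    and f :: "'v \<Rightarrow> 'w"
    and \<phi> :: "('p, 'a) fm"
  assumes "signature A AP"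
    and "simplicial_model A AP C"
    and "simplicial_model A AP D"
    and "pointed_morphism AP C X D Y f"
    and "guarded_positive A AP \<phi>"
    and "sat D Y \<phi>"
  shows "sat C X \<phi>"
proof -
  have mor: "morphism AP C D f" and X: "X \<in> facets C" and Y: "Y \<in> facets D" and XY: "f ` X \<subseteq> Y"
    using assms(4) by (auto simp: pointed_morphism_def)
  have facet_vertices: "Z \<subseteq> vertices C" if "Z \<in> facets C" for Z
    using assms(2) that simplex_vertices [of A C Z] by (simp add: simplicial_model_def facets_def)
  have colour: "colour D (f v) = colour C v" if "v \<in> Z" "Z \<in> facets C" for v Z
    using mor facet_vertices [OF that(2)] that(1) by (auto simp: morphism_def)
  \<comment> \<open>The facets vary, since \<open>K a\<close> leads to other ones; the morphism
    \<open>f\<close> is global and stays fixed.\<close>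
  from assms(5) X Y XY assms(6) show ?thesis
  proof (induction arbitrary: X Y)
    case (1 B bs \<psi>)
    show ?case
    proof (unfold sat_Imp, intro impI)
      assume "sat C X (alive_all (atoms_of AP A) bs)"
      then have B: "B \<subseteq> colour C ` X"
        using 1 by (simp add: sat_alive_all)
      also have "\<dots> \<subseteq> colour D ` Y"
      proof (rule image_subsetI)
        fix v assume "v \<in> X"
        then show "colour C v \<in> colour D ` Y"
          using colour [of v X] \<open>X \<in> facets C\<close> \<open>f ` X \<subseteq> Y\<close> by (metis image_eqI image_subset_iff)
      qed
      finally have \<psi>: "sat D Y \<psi>"
        using 1 by (simp add: sat_alive_all)
      \<comment> \<open>A morphism controls labels only on atoms of the colours of \<open>X\<close>;
        the guard, true at \<open>X\<close>, places \<open>B\<close> among these.\<close>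
      have "label D Y \<inter> atoms_of AP (colour C ` X) = label C X \<inter> atoms_of AP (colour C ` X)"
        using mor 1 by (auto simp: morphism_def)
      moreover have "atoms_of AP B \<subseteq> atoms_of AP (colour C ` X)"
        unfolding atoms_of_def using B by (rule UN_mono) simp
      ultimately have "label D Y \<inter> atoms_of AP B = label C X \<inter> atoms_of AP B"
        by blast
      then show "sat C X \<psi>"
        using sat_propositional_cong \<open>propositional (atoms_of AP B) \<psi>\<close> \<psi> by metis
    qed
  next
    case (4 a \<phi>)
    show ?case
    proof (unfold sat.simps, intro ballI impI)
      fix X' assume X': "X' \<in> facets C" and "a \<in> colour C ` (X \<inter> X')"
      then obtain v where v: "v \<in> X" "v \<in> X'" "a = colour C v"
        by blast
      \<comment> \<open>This image need not be a facet, as \<open>D\<close> may have larger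
        simplexes; a facet \<open>Y'\<close> above it still contains \<open>f v\<close>, which also
        lies in \<open>Y\<close>.\<close>
      have "f ` X' \<in> simplexes D"
        using mor X' by (auto simp: morphism_def facets_def)
      moreover have "finite A" "chromatic_complex A D"
        using assms(1,3) by (auto simp: signature_def simplicial_model_def)
      ultimately obtain Y' where Y': "Y' \<in> facets D" "f ` X' \<subseteq> Y'"
        using ex_facet_superset by blast
      have "f v \<in> Y \<inter> Y'" "a = colour D (f v)"
        using v X' Y'(2) \<open>f ` X \<subseteq> Y\<close> colour [OF v(2) X'] by auto
      then have "a \<in> colour D ` (Y \<inter> Y')"
        by blast
      then have "sat D Y' \<phi>"
        using \<open>sat D Y (K a \<phi>)\<close> Y'(1) unfolding sat.simps by blast
      with X' Y' show "sat C X' \<phi>"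
        by (rule "4.IH")
    qed
  next
    case (2 \<phi>1 \<phi>2)
    show ?case
      using 2(3,4) [OF 2(5-7)] 2(8) by simp
  next
    case (3 \<phi>1 \<phi>2)
    show ?case
      using 3(3,4) [OF 3(5-7)] 3(8) by auto
  qed
qed

end
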